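(* Let $R$ be a commutative ring with identity and let $S$ be a multiplicatively closed subset of $R$. If the formal power series ring $R[[X]]$ is a nonnil-$S$-Laskerian ring, then $R$ is an $S$-Laskerian ring.
   Context: $S\subseteq R$ is also regarded as a multiplicatively closed subset of $R[[X]]$. For a commutative ring $A$ with identity and a multiplicatively closed subset $S$ of $A$: $Nil(A)$ denotes the nilradical of $A$. An ideal $I$ of $A$ is nonnil if $I\nsubseteq Nil(A)$. $rad(Q)$ denotes the radical of an ideal $Q$. A proper ideal $Q$ of $A$ with $Q\cap S=\emptyset$ is $S$-primary if there exists $s\in S$ such that for all $a,b\in A$, if $ab\in Q$ then $sa\in Q$ or $sb\in rad(Q)$. An ideal $I$ of $A$ with $I\cap S=\emptyset$ is $S$-decomposable if it is a finite intersection of $S$-primary ideals of $A$. $A$ is $S$-Laskerian if every ideal of $A$ disjoint from $S$ is $S$-decomposable; $A$ is nonnil-$S$-Laskerian if every nonnil ideal of $A$ disjoint from $S$ is $S$-decomposable. *)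

theory Defs
  imports "HOL-Algebra.UnivPoly"
begin

section \<open>The formal power series ring over a ring\<close>

text \<open>
  The series with coefficients \<open>f 0, f 1, f 2, \<dots>\<close> is represented by its coefficient function
  \<open>f\<close>. This follows \<open>UP\<close> of \<open>HOL-Algebra.UnivPoly\<close>, without the finite support condition and
  without extensionality of the operations outside the carrier.
\<close>

definition power_series_ring :: "('a, 'm) ring_scheme \<Rightarrow> (nat \<Rightarrow> 'a) ring"
  where "power_series_ring R = \<lparr>
    carrier = UNIV \<rightarrow> carrier R,
    mult = (\<lambda>f g n. \<Oplus>\<^bsub>R\<^esub>i \<in> {..n}. f i \<otimes>\<^bsub>R\<^esub> g (n - i)),
    one = (\<lambda>n. if n = 0 then \<one>\<^bsub>R\<^esub> else \<zero>\<^bsub>R\<^esub>),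
    zero = (\<lambda>n. \<zero>\<^bsub>R\<^esub>),
    add = (\<lambda>f g n. f n \<oplus>\<^bsub>R\<^esub> g n)\<rparr>"

definition const_series :: "('a, 'm) ring_scheme \<Rightarrow> 'a \<Rightarrow> nat \<Rightarrow> 'a"
  where "const_series R a = (\<lambda>n. if n = 0 then a else \<zero>\<^bsub>R\<^esub>)"

text \<open>
  Coefficient \<open>n\<close> of a product only depends on the factors truncated at degree \<open>n\<close>, so
  associativity and commutativity carry over from polynomials.
\<close>

lemma power_series_ring_cring:
  assumes "cring R" shows "cring (power_series_ring R)"
proof -
  interpret R: cring R by fact
  let ?P = "power_series_ring R"
  define T where "T n f = (\<lambda>i. if i \<le> n then f i else \<zero>\<^bsub>R\<^esub>)" for n :: nat and f
  interpret U: UP_cring R "UP R" by unfold_locales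
  have T: "T n f \<in> carrier (UP R)" if "f \<in> carrier ?P" for n f
    using that by (auto simp: UP_def up_def T_def power_series_ring_def Pi_def bound_def intro!: exI[of _ n])
  have UP_mult: "(p \<otimes>\<^bsub>UP R\<^esub> q) n = (\<Oplus>\<^bsub>R\<^esub>i \<in> {..n}. p i \<otimes>\<^bsub>R\<^esub> q (n - i))"
    if "p \<in> carrier (UP R)" "q \<in> carrier (UP R)" for p q n
    using that by (simp add: UP_def)
  have mult_closed: "f \<otimes>\<^bsub>?P\<^esub> g \<in> carrier ?P" if "f \<in> carrier ?P" "g \<in> carrier ?P" for f g
    using that by (auto simp: power_series_ring_def Pi_def)
  have mult_cong: "(f \<otimes>\<^bsub>?P\<^esub> g) n = (p \<otimes>\<^bsub>UP R\<^esub> q) n"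
    if "f \<in> carrier ?P" "g \<in> carrier ?P" "p \<in> carrier (UP R)" "q \<in> carrier (UP R)"
      "\<And>i. i \<le> n \<Longrightarrow> f i = p i" "\<And>i. i \<le> n \<Longrightarrow> g i = q i" for f g p q n
    unfolding UP_mult[OF that(3,4)] using that mem_upD[of _ R]
    by (auto simp: power_series_ring_def Pi_def UP_def intro!: R.finsum_cong')
  have TT: "(f \<otimes>\<^bsub>?P\<^esub> g) k = (T n f \<otimes>\<^bsub>UP R\<^esub> T n g) k"
    if "f \<in> carrier ?P" "g \<in> carrier ?P" "k \<le> n" for f g k n
    using that by (intro mult_cong T) (auto simp: T_def)
  have assoc: "(f \<otimes>\<^bsub>?P\<^esub> g) \<otimes>\<^bsub>?P\<^esub> h = f \<otimes>\<^bsub>?P\<^esub> (g \<otimes>\<^bsub>?P\<^esub> h)"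
    if fgh: "f \<in> carrier ?P" "g \<in> carrier ?P" "h \<in> carrier ?P" for f g h
  proof
    fix n
    have "((f \<otimes>\<^bsub>?P\<^esub> g) \<otimes>\<^bsub>?P\<^esub> h) n = ((T n f \<otimes>\<^bsub>UP R\<^esub> T n g) \<otimes>\<^bsub>UP R\<^esub> T n h) n"
      by (intro mult_cong mult_closed U.UP_mult_closed T TT fgh) (auto simp: T_def)
    also have "\<dots> = (T n f \<otimes>\<^bsub>UP R\<^esub> (T n g \<otimes>\<^bsub>UP R\<^esub> T n h)) n"
      using fgh by (simp add: U.UP_m_assoc T)
    also have "\<dots> = (f \<otimes>\<^bsub>?P\<^esub> (g \<otimes>\<^bsub>?P\<^esub> h)) n"
      by (rule sym, intro mult_cong mult_closed U.UP_mult_closed T TT fgh) (auto simp: T_def)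
    finally show "((f \<otimes>\<^bsub>?P\<^esub> g) \<otimes>\<^bsub>?P\<^esub> h) n = (f \<otimes>\<^bsub>?P\<^esub> (g \<otimes>\<^bsub>?P\<^esub> h)) n" .
  qed
  have comm: "f \<otimes>\<^bsub>?P\<^esub> g = g \<otimes>\<^bsub>?P\<^esub> f" if "f \<in> carrier ?P" "g \<in> carrier ?P" for f g
  proof
    fix n
    show "(f \<otimes>\<^bsub>?P\<^esub> g) n = (g \<otimes>\<^bsub>?P\<^esub> f) n"
      using that by (simp add: TT[where n = n] U.UP_m_comm T)
  qed
  have one_closed: "\<one>\<^bsub>?P\<^esub> \<in> carrier ?P"
    by (auto simp: power_series_ring_def)
  have one: "\<one>\<^bsub>?P\<^esub> \<otimes>\<^bsub>?P\<^esub> f = f" if f: "f \<in> carrier ?P" for f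
  proof
    fix n
    show "(\<one>\<^bsub>?P\<^esub> \<otimes>\<^bsub>?P\<^esub> f) n = f n"
    proof (cases n)
      case 0 with f show ?thesis by (simp add: power_series_ring_def Pi_def)
    next
      case Suc with f show ?thesis
        by (simp del: R.finsum_Suc add: R.finsum_Suc2 Pi_def power_series_ring_def)
    qed
  qed
  show ?thesis
  proof (rule cringI)
    show "abelian_group ?P"
    proof (rule abelian_groupI)
      fix x assume "x \<in> carrier ?P"
      then show "\<exists>y\<in>carrier ?P. y \<oplus>\<^bsub>?P\<^esub> x = \<zero>\<^bsub>?P\<^esub>"
        by (intro bexI[of _ "\<lambda>i. \<ominus>\<^bsub>R\<^esub> x i"]) (auto simp: power_series_ring_def Pi_def R.l_neg)
    qed (auto simp: power_series_ring_def Pi_def R.a_ac)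
    show "Group.comm_monoid ?P"
    proof (rule comm_monoidI)
    qed (use assoc comm one mult_closed in \<open>simp_all add: one_closed\<close>)
    show "(x \<oplus>\<^bsub>?P\<^esub> y) \<otimes>\<^bsub>?P\<^esub> z = x \<otimes>\<^bsub>?P\<^esub> z \<oplus>\<^bsub>?P\<^esub> y \<otimes>\<^bsub>?P\<^esub> z"
      if "x \<in> carrier ?P" "y \<in> carrier ?P" "z \<in> carrier ?P" for x y z
      using that by (auto simp: power_series_ring_def Pi_def R.l_distr)
  qed
qed

lemma const_series_hom:
  assumes "cring R" shows "const_series R \<in> ring_hom R (power_series_ring R)"
proof -
  interpret R: cring R by fact
  have "(\<Oplus>\<^bsub>R\<^esub>i\<in>{..n}. (if i = 0 then x else \<zero>\<^bsub>R\<^esub>) \<otimes>\<^bsub>R\<^esub> (if n - i = 0 then y else \<zero>\<^bsub>R\<^esub>)) =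
    (if n = 0 then x \<otimes>\<^bsub>R\<^esub> y else \<zero>\<^bsub>R\<^esub>)" if "x \<in> carrier R" "y \<in> carrier R" for x y and n :: nat
  proof (cases n)
    case 0 with that show ?thesis by simp
  next
    case Suc with that show ?thesis
      by (simp del: R.finsum_Suc add: R.finsum_Suc2 Pi_def)
  qed
  then show ?thesis
    by (intro ring_hom_memI) (auto simp: const_series_def power_series_ring_def)
qed

lemma const_series_submonoid:
  assumes "cring R" "submonoid S R"
  shows "submonoid (const_series R ` S) (power_series_ring R)"
proof -
  interpret S: submonoid S R by fact
  note h = const_series_hom[OF assms(1)]
  show ?thesis
  proof
    show "const_series R ` S \<subseteq> carrier (power_series_ring R)"
      using S.subset ring_hom_closed[OF h] by auto
    show "\<one>\<^bsub>power_series_ring R\<^esub> \<in> const_series R ` S"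
      using ring_hom_one[OF h] S.one_closed by (metis imageI)
    fix x y assume "x \<in> const_series R ` S" "y \<in> const_series R ` S"
    then obtain a b where "a \<in> S" "b \<in> S" "x = const_series R a" "y = const_series R b" by auto
    then show "x \<otimes>\<^bsub>power_series_ring R\<^esub> y \<in> const_series R ` S"
      using ring_hom_mult[OF h, of a b] S.subset S.m_closed by (metis imageI subsetD)
  qed
qed

section \<open>Nonnil ideals and \<open>S\<close>-primary decomposition\<close>

text \<open>
  The definitions below are meant for a commutative ring \<open>A\<close> and a multiplicatively closed
  \<open>S \<subseteq> carrier A\<close> (\<open>submonoid S A\<close>, so \<open>\<one> \<in> S\<close>; \<open>\<zero> \<in> S\<close> is not excluded).
\<close>

definition rad :: "('a, 'm) ring_scheme \<Rightarrow> 'a set \<Rightarrow> 'a set"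
  where "rad A Q = {a \<in> carrier A. \<exists>n::nat. n > 0 \<and> a [^]\<^bsub>A\<^esub> n \<in> Q}"

definition nilradical :: "('a, 'm) ring_scheme \<Rightarrow> 'a set"
  where "nilradical A = {a \<in> carrier A. \<exists>n::nat. n > 0 \<and> a [^]\<^bsub>A\<^esub> n = \<zero>\<^bsub>A\<^esub>}"

definition nonnil_ideal :: "('a, 'm) ring_scheme \<Rightarrow> 'a set \<Rightarrow> bool"
  where "nonnil_ideal A I \<longleftrightarrow> ideal I A \<and> \<not> I \<subseteq> nilradical A"

definition S_primary :: "('a, 'm) ring_scheme \<Rightarrow> 'a set \<Rightarrow> 'a set \<Rightarrow> bool"
  where "S_primary A S Q \<longleftrightarrow>
    ideal Q A \<and> Q \<noteq> carrier A \<and> Q \<inter> S = {} \<and>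
    (\<exists>s\<in>S. \<forall>a\<in>carrier A. \<forall>b\<in>carrier A.
      a \<otimes>\<^bsub>A\<^esub> b \<in> Q \<longrightarrow> s \<otimes>\<^bsub>A\<^esub> a \<in> Q \<or> s \<otimes>\<^bsub>A\<^esub> b \<in> rad A Q)"

text \<open>
  The family is required to be nonempty because \<open>\<Inter>{}\<close> is \<open>UNIV\<close>. The empty intersection taken in
  \<open>A\<close> would be \<open>carrier A\<close>, which is never disjoint from \<open>S\<close> as \<open>\<one> \<in> S\<close>.
\<close>

definition S_decomposable :: "('a, 'm) ring_scheme \<Rightarrow> 'a set \<Rightarrow> 'a set \<Rightarrow> bool"
  where "S_decomposable A S I \<longleftrightarrow>
    ideal I A \<and> I \<inter> S = {} \<and>
    (\<exists>\<Q>. finite \<Q> \<and> \<Q> \<noteq> {} \<and> (\<forall>Q\<in>\<Q>. S_primary A S Q) \<and> I = \<Inter>\<Q>)"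

definition S_Laskerian :: "('a, 'm) ring_scheme \<Rightarrow> 'a set \<Rightarrow> bool"
  where "S_Laskerian A S \<longleftrightarrow>
    (\<forall>I. ideal I A \<and> I \<inter> S = {} \<longrightarrow> S_decomposable A S I)"

definition nonnil_S_Laskerian :: "('a, 'm) ring_scheme \<Rightarrow> 'a set \<Rightarrow> bool"
  where "nonnil_S_Laskerian A S \<longleftrightarrow>
    (\<forall>I. nonnil_ideal A I \<and> I \<inter> S = {} \<longrightarrow> S_decomposable A S I)"

end

(*
  The ideal J of all series whose constant term lies in I contains X, so it is nonnil unless R is
  trivial; and I is the contraction of J along the embedding of R as constant series. Contraction
  along a ring homomorphism preserves S-primary ideals and intersections, so an S-primary
  decomposition of J contracts to one of I.
*)
theory Submission
  imports Defs "HOL-Algebra.QuotRing"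
begin

text \<open>The element \<open>s\<close> whose image \<open>h s\<close> serves for \<open>Q\<close>
  also serves for the preimage: both alternatives in the definition pull back along
  \<open>h\<close>.\<close>

lemma S_primary_vimage:
  assumes "cring A" "cring B" "h \<in> ring_hom A B" "submonoid S A" "S_primary B (h ` S) Q"
  shows "S_primary A S {a \<in> carrier A. h a \<in> Q}"
proof -
  interpret A: cring A by fact
  interpret B: cring B by fact
  interpret S: submonoid S A by fact
  interpret h: ring_hom_ring A B h by unfold_locales (rule assms)
  from assms(5) obtain s where Q: "ideal Q B" "Q \<inter> h ` S = {}" and s: "s \<in> S"
    and prim: "\<And>a b. a \<in> carrier B \<Longrightarrow> b \<in> carrier B \<Longrightarrow> a \<otimes>\<^bsub>B\<^esub> b \<in> Q \<Longrightarrow>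
      h s \<otimes>\<^bsub>B\<^esub> a \<in> Q \<or> h s \<otimes>\<^bsub>B\<^esub> b \<in> rad B Q"
    by (auto simp: S_primary_def)
  let ?P = "{a \<in> carrier A. h a \<in> Q}"
  have sA: "s \<in> carrier A" using s S.subset by auto
  have disj: "?P \<inter> S = {}" using Q(2) by auto
  have "s \<otimes>\<^bsub>A\<^esub> a \<in> ?P \<or> s \<otimes>\<^bsub>A\<^esub> b \<in> rad A ?P"
    if "a \<in> carrier A" "b \<in> carrier A" "a \<otimes>\<^bsub>A\<^esub> b \<in> ?P" for a b
  proof -
    have "h s \<otimes>\<^bsub>B\<^esub> h a \<in> Q \<or> h s \<otimes>\<^bsub>B\<^esub> h b \<in> rad B Q"
      using prim[of "h a" "h b"] that by simp
    \<comment> \<open>Since \<open>h\<close> commutes with powers, an exponent witnessing membership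
      in \<open>rad B Q\<close> also witnesses membership in the radical of the preimage.\<close>
    moreover have "h ((s \<otimes>\<^bsub>A\<^esub> b) [^]\<^bsub>A\<^esub> n) = (h s \<otimes>\<^bsub>B\<^esub> h b) [^]\<^bsub>B\<^esub> n" for n :: nat
      using that sA by (induction n) simp_all
    ultimately show ?thesis
      using that sA by (auto simp: rad_def)
  qed
  \<comment> \<open>Properness of \<open>?P\<close> follows from its disjointness from
    \<open>S\<close>, because \<open>S\<close> contains \<open>\<one>\<close>.\<close>
  then show ?thesis
    using h.ideal_vimage[OF Q(1)] disj S.one_closed s
    unfolding S_primary_def by blast
qed

text \<open>Preimages commute with intersections, so contracting every component of a decomposition
  of \<open>J\<close> decomposes the contraction of \<open>J\<close>.\<close>

lemma S_decomposable_vimage: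
  assumes "cring A" "cring B" "h \<in> ring_hom A B" "submonoid S A" "S_decomposable B (h ` S) J"
  shows "S_decomposable A S {a \<in> carrier A. h a \<in> J}"
proof -
  interpret A: cring A by fact
  interpret B: cring B by fact
  interpret h: ring_hom_ring A B h by unfold_locales (rule assms)
  from assms(5) have J: "ideal J B" "J \<inter> h ` S = {}"
    unfolding S_decomposable_def by blast+
  from assms(5) obtain \<Q> where
    \<Q>: "finite \<Q>" "\<Q> \<noteq> {}" "\<forall>Q\<in>\<Q>. S_primary B (h ` S) Q" and J_eq: "J = \<Inter>\<Q>"
    unfolding S_decomposable_def by blast
  define c where "c Q = {a \<in> carrier A. h a \<in> Q}" for Q
  have "finite (c ` \<Q>)" "c ` \<Q> \<noteq> {}" using \<Q>(1,2) by simp_all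
  moreover have "\<forall>P\<in>c ` \<Q>. S_primary A S P"
    using S_primary_vimage[OF assms(1-4)] \<Q>(3) by (simp add: c_def)
  \<comment> \<open>Nonemptiness matters: for an empty family the left side would be
    \<open>carrier A\<close> and the right side \<open>UNIV\<close>.\<close>
  moreover have "c J = \<Inter>(c ` \<Q>)" unfolding J_eq c_def using \<Q>(2) by blast
  moreover have "c J \<inter> S = {}" unfolding c_def using J(2) by blast
  moreover have "ideal (c J) A" unfolding c_def by (rule h.ideal_vimage[OF J(1)])
  ultimately have "S_decomposable A S (c J)"
    unfolding S_decomposable_def by blast
  then show ?thesis by (simp add: c_def)
qed

text \<open>Makes the set of series with constant term in a given ideal an ideal, as a preimage.
  Coefficient 0 of a product has the single summand \<open>f 0 \<otimes> g 0\<close>.\<close>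

lemma constant_term_hom:
  assumes "cring R" shows "(\<lambda>f. f 0) \<in> ring_hom (power_series_ring R) R"
proof -
  interpret R: cring R by fact
  show ?thesis
    by (intro ring_hom_memI) (auto simp: power_series_ring_def Pi_def)
qed

definition series_X :: "('a, 'm) ring_scheme \<Rightarrow> nat \<Rightarrow> 'a"
  where "series_X R = (\<lambda>n. if n = 1 then \<one>\<^bsub>R\<^esub> else \<zero>\<^bsub>R\<^esub>)"

lemma series_X_closed:
  assumes "cring R" shows "series_X R \<in> carrier (power_series_ring R)"
proof -
  interpret R: cring R by fact
  show ?thesis by (auto simp: series_X_def power_series_ring_def)
qed

text \<open>Multiplication by X shifts coefficients by one. The formula shows that X is not
  nilpotent once \<open>\<one>\<close> and \<open>\<zero>\<close> differ.\<close>

lemma series_X_pow: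
  assumes "cring R"
  shows "series_X R [^]\<^bsub>power_series_ring R\<^esub> k = (\<lambda>n. if n = k then \<one>\<^bsub>R\<^esub> else \<zero>\<^bsub>R\<^esub>)"
proof (induction k)
  case 0
  then show ?case by (simp add: nat_pow_def power_series_ring_def)
next
  case (Suc k)
  interpret R: cring R by fact
  interpret P: cring "power_series_ring R" by (rule power_series_ring_cring) fact
  have "(\<Oplus>\<^bsub>R\<^esub>i\<in>{..n}. (if i = k then \<one>\<^bsub>R\<^esub> else \<zero>\<^bsub>R\<^esub>) \<otimes>\<^bsub>R\<^esub> series_X R (n - i)) =
    (if n = Suc k then \<one>\<^bsub>R\<^esub> else \<zero>\<^bsub>R\<^esub>)" for n
  proof -
    \<comment> \<open>Only the index \<open>i = k\<close> can contribute, and it does so exactly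
      when \<open>n - k = 1\<close>. The test is written \<open>k = i\<close> to match
      \<open>finsum_singleton\<close>.\<close>
    have "(\<Oplus>\<^bsub>R\<^esub>i\<in>{..n}. (if i = k then \<one>\<^bsub>R\<^esub> else \<zero>\<^bsub>R\<^esub>) \<otimes>\<^bsub>R\<^esub> series_X R (n - i)) =
      (\<Oplus>\<^bsub>R\<^esub>i\<in>{..n}. if k = i then (if n = Suc k then \<one>\<^bsub>R\<^esub> else \<zero>\<^bsub>R\<^esub>) else \<zero>\<^bsub>R\<^esub>)"
      by (rule R.finsum_cong') (auto simp: series_X_def)
    also have "\<dots> = (if n = Suc k then \<one>\<^bsub>R\<^esub> else \<zero>\<^bsub>R\<^esub>)"
    proof (cases "k \<le> n")
      case True
      then show ?thesis
        using R.finsum_singleton[of k "{..n}" "\<lambda>_. if n = Suc k then \<one>\<^bsub>R\<^esub> else \<zero>\<^bsub>R\<^esub>"] by simp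
    next
      case False
      then have "(\<Oplus>\<^bsub>R\<^esub>i\<in>{..n}. if k = i then (if n = Suc k then \<one>\<^bsub>R\<^esub> else \<zero>\<^bsub>R\<^esub>) else \<zero>\<^bsub>R\<^esub>) =
        (\<Oplus>\<^bsub>R\<^esub>i\<in>{..n}. \<zero>\<^bsub>R\<^esub>)"
        by (intro R.finsum_cong') auto
      with False show ?thesis by simp
    qed
    finally show ?thesis .
  qed
  then have "(\<lambda>n. if n = k then \<one>\<^bsub>R\<^esub> else \<zero>\<^bsub>R\<^esub>) \<otimes>\<^bsub>power_series_ring R\<^esub> series_X R =
    (\<lambda>n. if n = Suc k then \<one>\<^bsub>R\<^esub> else \<zero>\<^bsub>R\<^esub>)"
    by (simp add: power_series_ring_def)
  then show ?case
    by (simp add: Suc)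
qed

theorem proposition2p16:
  fixes R :: "('a, 'm) ring_scheme" and S :: "'a set"
  assumes "cring R"
    and "submonoid S R"
    and "nonnil_S_Laskerian (power_series_ring R) (const_series R ` S)"
  shows "S_Laskerian R S"
  unfolding S_Laskerian_def
proof (intro allI impI)
  fix I assume "ideal I R \<and> I \<inter> S = {}"
  then have I: "ideal I R" and disj: "I \<inter> S = {}" by auto
  let ?P = "power_series_ring R"
  interpret R: cring R by fact
  interpret S: submonoid S R by fact
  interpret I: ideal I R by fact
  note P = power_series_ring_cring[OF assms(1)]
  interpret h: ring_hom_ring ?P R "\<lambda>f. f 0"
    by (intro ring_hom_ringI2 cring.axioms(1)[OF P] R.ring_axioms constant_term_hom[OF assms(1)])
  let ?J = "{f \<in> carrier ?P. f 0 \<in> I}"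
  \<comment> \<open>The trivial ring is excluded by disjointness: there \<open>\<one>\<close> would
    equal \<open>\<zero>\<close> and lie in both \<open>S\<close> and \<open>I\<close>.\<close>
  have "\<one>\<^bsub>R\<^esub> \<noteq> \<zero>\<^bsub>R\<^esub>"
    using disj S.one_closed I.zero_closed by (metis disjoint_iff)
  then have "series_X R [^]\<^bsub>?P\<^esub> n \<noteq> \<zero>\<^bsub>?P\<^esub>" for n :: nat
    unfolding series_X_pow[OF assms(1)] by (auto simp: power_series_ring_def fun_eq_iff)
  then have "series_X R \<notin> nilradical ?P"
    by (auto simp: nilradical_def)
  moreover have "series_X R \<in> ?J"
    using series_X_closed[OF assms(1)] by (simp add: series_X_def)
  ultimately have "nonnil_ideal ?P ?J"
    using h.ideal_vimage[OF I]
    by (auto simp: nonnil_ideal_def)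
  moreover have "?J \<inter> const_series R ` S = {}"
    using disj by (auto simp: const_series_def)
  ultimately have "S_decomposable ?P (const_series R ` S) ?J"
    using assms(3) by (auto simp: nonnil_S_Laskerian_def)
  then have "S_decomposable R S {a \<in> carrier R. const_series R a \<in> ?J}"
    by (rule S_decomposable_vimage[OF assms(1) P const_series_hom[OF assms(1)] assms(2)])
  \<comment> \<open>Taking the constant term undoes \<open>const_series\<close>, so contracting
    \<open>?J\<close> gives back exactly \<open>I\<close>.\<close>
  moreover have "{a \<in> carrier R. const_series R a \<in> ?J} = I"
    using I.a_subset ring_hom_closed[OF const_series_hom[OF assms(1)]]
    by (auto simp: const_series_def)
  ultimately show "S_decomposable R S I" by simp
qed

end
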